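(* Let $\mathcal{A}$ be a unital Banach algebra, let $n\geq 1$ be an integer, and let $a_0,a_1,\dots,a_n\in\mathcal{A}$ with $a_n$ invertible. Let $p(z)=a_0+za_1+\cdots+z^{n-1}a_{n-1}+z^na_n\in\mathcal{A}[z]$. Let $u\in\mathcal{A}$ be such that $p(u)=0$ and $\|u^n\|=\|u\|^n$. Then $$\|u\|<1+\max_{0\leq j\leq n-1}\|a_ja_n^{-1}\|\leq 1+\|a_n^{-1}\|\max_{0\leq j\leq n-1}\|a_j\|.$$
   Context: Here $\mathcal{A}$ is a (possibly noncommutative) Banach algebra with unit $1\neq 0$, and $\mathcal{A}[z]$ is the set of polynomials over $\mathcal{A}$. In this statement coefficients are written on the right of the powers of $z$, and $p(u)$ means $p(u)=a_0+ua_1+\cdots+u^{n-1}a_{n-1}+u^na_n$. *)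

theory Defs
  imports Complex_Main "HOL-Computational_Algebra.Polynomial"
begin

text \<open>
  A Banach algebra need not be a division ring, so the library's \<open>inverse\<close> is not available.
  \<open>mult_inverse x\<close> is meaningful only if \<open>mult_invertible x\<close> holds.
\<close>

definition mult_invertible :: "'a::monoid_mult \<Rightarrow> bool" where
  "mult_invertible x \<longleftrightarrow> (\<exists>y. x * y = 1 \<and> y * x = 1)"

definition mult_inverse :: "'a::monoid_mult \<Rightarrow> 'a" where
  "mult_inverse x = (THE y. x * y = 1 \<and> y * x = 1)"

lemma mult_inverse_unique:
  assumes "x * y = 1" "y * x = 1"
  shows "mult_inverse x = y"
  unfolding mult_inverse_def
proof (rule the_equality)
  fix z assume z: "x * z = 1 \<and> z * x = 1"
  have "z = (y * x) * z" using assms by simp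
  also have "\<dots> = y" using z by (simp add: mult.assoc)
  finally show "z = y" .
qed (use assms in auto)

text \<open>
  The library function \<open>poly\<close> requires a commutative coefficient ring. Over a noncommutative ring
  the side on which coefficients stand matters: here they stand to the right of the powers.
\<close>

definition poly_right :: "'a::semiring_1 poly \<Rightarrow> 'a \<Rightarrow> 'a" where
  "poly_right p u = (\<Sum>j\<le>degree p. u ^ j * coeff p j)"

lemma poly_right_sum_monom:
  "poly_right (\<Sum>j\<le>n. monom (a j) j) u = (\<Sum>j\<le>n. u ^ j * a j)"
proof -
  define p where "p = (\<Sum>j\<le>n. monom (a j) j)"
  have coeff: "coeff p j = (if j \<le> n then a j else 0)" for j
    by (simp add: p_def coeff_sum)
  have "degree p \<le> n"
    by (rule degree_le) (simp add: coeff)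
  then have "(\<Sum>j\<le>degree p. u ^ j * coeff p j) = (\<Sum>j\<le>n. u ^ j * coeff p j)"
    by (intro sum.mono_neutral_left) (auto simp: coeff_eq_0)
  also have "\<dots> = (\<Sum>j\<le>n. u ^ j * a j)"
    by (simp add: coeff)
  finally show ?thesis
    by (simp add: poly_right_def p_def)
qed

end

theory Submission
  imports Defs
begin

text \<open>
  This is Cauchy's bound for the zeros of a polynomial. Multiplying \<open>p(u) = 0\<close> on the right by
  \<open>a\<^sub>n\<^sup>-\<^sup>1\<close> makes the polynomial monic without disturbing the powers of \<open>u\<close>, since the coefficients
  stand on the right: \<open>u\<^sup>n = - (\<Sum>j<n. u\<^sup>j * b\<^sub>j)\<close> with \<open>b\<^sub>j = a\<^sub>j * a\<^sub>n\<^sup>-\<^sup>1\<close>. Put \<open>r = \<parallel>u\<parallel>\<close> and let \<open>M\<close>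
  be the maximum of the \<open>\<parallel>b\<^sub>j\<parallel>\<close>. Submultiplicativity bounds the right side by \<open>M * (\<Sum>j<n. r\<^sup>j)\<close>, but
  in general it also gives only \<open>\<parallel>u\<^sup>n\<parallel> \<le> r\<^sup>n\<close>; the assumption \<open>\<parallel>u\<^sup>n\<parallel> = \<parallel>u\<parallel>\<^sup>n\<close> is what turns this into
  the scalar inequality \<open>r\<^sup>n \<le> M * (\<Sum>j<n. r\<^sup>j)\<close>. Summing the geometric series
  (\<open>less_one_plus_if_power_le_geometric\<close>) then forces \<open>r < 1 + M\<close>. The second inequality is
  submultiplicativity applied to each \<open>a\<^sub>j * a\<^sub>n\<^sup>-\<^sup>1\<close>.
\<close>

text \<open>
  The factor \<open>b\<close> absorbs the unit in the case \<open>j = 0\<close>, so that \<open>\<parallel>1\<parallel>\<close> never enters. A bound on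
  \<open>\<parallel>u\<^sup>j\<parallel>\<close> alone would cost a factor \<open>\<parallel>1\<parallel>\<close>, which may exceed \<open>1\<close> in a \<open>real_normed_algebra\<close>.
\<close>

lemma norm_power_mult_le:
  fixes u b :: "'a::{real_algebra_1, real_normed_algebra}"
  shows "norm (u ^ j * b) \<le> norm u ^ j * norm b"
proof (induction j)
  case (Suc j)
  have "norm (u ^ Suc j * b) \<le> norm u * norm (u ^ j * b)"
    using norm_mult_ineq[of u "u ^ j * b"] by (simp add: mult.assoc)
  also have "\<dots> \<le> norm u * (norm u ^ j * norm b)"
    using Suc.IH by (simp add: mult_left_mono)
  finally show ?case
    by (simp add: mult.assoc)
qed simp

text \<open>
  Multiplied by \<open>r - 1\<close>, the hypothesis reads \<open>(r - 1) * r\<^sup>n \<le> M * (r\<^sup>n - 1)\<close>. If \<open>M \<le> r - 1\<close>, the right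
  side is at most \<open>(r - 1) * (r\<^sup>n - 1)\<close>, whence \<open>r \<le> 1\<close>; then \<open>M = 0\<close> and the hypothesis itself says
  \<open>r\<^sup>n \<le> 0\<close>, which is absurd for \<open>r = 1\<close>.
\<close>

lemma less_one_plus_if_power_le_geometric:
  fixes r M :: real
  assumes "0 \<le> M" and le: "r ^ n \<le> M * (\<Sum>j<n. r ^ j)"
  shows "r < 1 + M"
proof (rule ccontr)
  assume "\<not> r < 1 + M"
  then have M: "M \<le> r - 1" by simp
  then have "1 \<le> r" using \<open>0 \<le> M\<close> by simp
  then have "1 \<le> r ^ n" by simp
  have "(r - 1) * r ^ n \<le> (r - 1) * (M * (\<Sum>j<n. r ^ j))"
    using le \<open>1 \<le> r\<close> by (intro mult_left_mono) auto
  also have "\<dots> = M * (r ^ n - 1)"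
    by (simp add: power_diff_1_eq)
  also have "\<dots> \<le> (r - 1) * (r ^ n - 1)"
    using M \<open>1 \<le> r ^ n\<close> by (intro mult_right_mono) auto
  finally have "r \<le> 1" by (simp add: right_diff_distrib)
  then have "M = 0" using M \<open>0 \<le> M\<close> by simp
  then show False using le \<open>1 \<le> r ^ n\<close> by simp
qed

text \<open>
  The bound for monic polynomials, with the relation \<open>p(u) = 0\<close> solved for the leading power.
\<close>

lemma norm_less_of_monic_root:
  fixes u :: "'a::{real_algebra_1, real_normed_algebra}"
  assumes root: "u ^ n = - (\<Sum>j<n. u ^ j * b j)"
    and power: "norm (u ^ n) = norm u ^ n"
    and "0 \<le> M" and b: "\<And>j. j < n \<Longrightarrow> norm (b j) \<le> M"
  shows "norm u < 1 + M"
proof (rule less_one_plus_if_power_le_geometric[OF \<open>0 \<le> M\<close>])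
  have "norm u ^ n = norm (\<Sum>j<n. u ^ j * b j)"
    unfolding power[symmetric] root by simp
  also have "\<dots> \<le> (\<Sum>j<n. norm u ^ j * M)"
  proof (rule sum_norm_le)
    fix j assume "j \<in> {..<n}"
    then have "norm u ^ j * norm (b j) \<le> norm u ^ j * M"
      by (intro mult_left_mono b) auto
    then show "norm (u ^ j * b j) \<le> norm u ^ j * M"
      by (rule order_trans[OF norm_power_mult_le])
  qed
  finally show "norm u ^ n \<le> M * (\<Sum>j<n. norm u ^ j)"
    by (simp add: sum_distrib_left mult.commute)
qed

theorem theorem2p5:
  fixes a :: "nat \<Rightarrow> 'a::{real_algebra_1, real_normed_algebra, banach}"
    and p :: "'a poly" and u :: 'a and n :: nat
  assumes "n \<ge> 1"
    and "mult_invertible (a n)"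
    and "p = (\<Sum>j\<le>n. monom (a j) j)"
    and "poly_right p u = 0"
    and "norm (u ^ n) = norm u ^ n"
  shows "norm u < 1 + (MAX j\<in>{0..n-1}. norm (a j * mult_inverse (a n))) \<and>
         1 + (MAX j\<in>{0..n-1}. norm (a j * mult_inverse (a n)))
           \<le> 1 + norm (mult_inverse (a n)) * (MAX j\<in>{0..n-1}. norm (a j))"
proof -
  define c where "c = mult_inverse (a n)"
  have inverse: "a n * c = 1"
    using assms(2) mult_inverse_unique unfolding mult_invertible_def c_def by metis
  define M where "M = (MAX j\<in>{0..n-1}. norm (a j * c))"
  have le_M: "norm (a j * c) \<le> M" if "j < n" for j
    unfolding M_def using that by (intro Max_ge) auto
  have "0 \<le> M"
    using le_M[of 0] \<open>n \<ge> 1\<close> norm_ge_zero[of "a 0 * c"] by linarith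
  have "u ^ n = - (\<Sum>j<n. u ^ j * (a j * c))"
  proof -
    have "0 = (\<Sum>j\<le>n. u ^ j * a j) * c"
      using assms(3,4) by (simp add: poly_right_sum_monom)
    also have "\<dots> = (\<Sum>j<n. u ^ j * (a j * c)) + u ^ n"
      by (simp add: distrib_right sum_distrib_right mult.assoc inverse flip: lessThan_Suc_atMost)
    finally show ?thesis
      by (simp add: eq_neg_iff_add_eq_0 add.commute)
  qed
  from norm_less_of_monic_root[OF this assms(5) \<open>0 \<le> M\<close> le_M]
  have "norm u < 1 + M" .
  moreover have "M \<le> norm c * (MAX j\<in>{0..n-1}. norm (a j))"
    unfolding M_def
  proof (rule Max.boundedI)
    fix x assume "x \<in> (\<lambda>j. norm (a j * c)) ` {0..n-1}"
    then obtain j where j: "j \<in> {0..n-1}" and x: "x = norm (a j * c)" by blast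
    have "x \<le> norm c * norm (a j)"
      unfolding x using norm_mult_ineq[of "a j" c] by (simp add: mult.commute)
    also have "\<dots> \<le> norm c * (MAX j\<in>{0..n-1}. norm (a j))"
      using j by (intro mult_left_mono Max_ge) auto
    finally show "x \<le> norm c * (MAX j\<in>{0..n-1}. norm (a j))" .
  qed auto
  ultimately show ?thesis
    unfolding M_def c_def by simp
qed

end
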